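(* For every $\theta\in(0,1)$ there exist constants $\delta_0=\delta_0(\theta)>0$ and $C(\theta)>0$, depending only on $\theta$, such that the following holds. Let $I\subset\mathbb{R}$ be an open interval equipped with a probability measure $\mathfrak{m}=e^{-\psi}\,dx$, where $\psi:I\to\mathbb{R}$ is $1$-convex. Let $0<\delta<\delta_0$ and suppose that $$\mathfrak{m}\big((-\infty,a_\theta]\cap I\big)=\theta\qquad\text{and}\qquad e^{-\psi(a_\theta)}\le e^{-\boldsymbol{\psi}_{\mathrm g}(a_\theta)}+\delta .$$ Then $$W_2(\mathfrak{m},\boldsymbol{\gamma})\le C(\theta)\sqrt{\delta}.$$
   Context: A function $\psi:I\to\mathbb{R}$ on an interval is called $1$-convex if $\psi((1-t)x+ty)\le(1-t)\psi(x)+t\psi(y)-\tfrac12(1-t)t|x-y|^2$ for all $x,y\in I$ and $t\in(0,1)$. $\boldsymbol{\gamma}(dx)=(2\pi)^{-1/2}e^{-x^2/2}\,dx=e^{-\boldsymbol{\psi}_{\mathrm g}(x)}\,dx$ is the standard Gaussian measure on $\mathbb{R}$, so $\boldsymbol{\psi}_{\mathrm g}(x)=x^2/2+\tfrac12\log(2\pi)$. For $\theta\in(0,1)$, $a_\theta\in\mathbb{R}$ is defined by $\boldsymbol{\gamma}((-\infty,a_\theta])=\theta$. (The condition $\mathfrak{m}((-\infty,a_\theta]\cap I)=\theta\in(0,1)$ forces $a_\theta\in I$, so $\psi(a_\theta)$ makes sense.) $W_2$ is the $L^2$-Wasserstein distance between probability measures on $\mathbb{R}$ with finite second moment (with cost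 $|x-y|^2$): $W_2(\mu,\nu)=\inf_\pi\big(\int_{\mathbb{R}\times\mathbb{R}}|x-y|^2\,d\pi\big)^{1/2}$ over couplings $\pi$ of $\mu$ and $\nu$; $\mathfrak{m}$ is regarded as a measure on $\mathbb{R}$ vanishing outside $I$. *)

theory Defs
  imports "HOL-Probability.Probability"
begin

definition one_convex_on :: "real set \<Rightarrow> (real \<Rightarrow> real) \<Rightarrow> bool" where
  "one_convex_on I \<psi> \<longleftrightarrow>
    (\<forall>x\<in>I. \<forall>y\<in>I. \<forall>t\<in>{0<..<1}.
      \<psi> ((1 - t) * x + t * y)
        \<le> (1 - t) * \<psi> x + t * \<psi> y - 1 / 2 * (1 - t) * t * \<bar>x - y\<bar>\<^sup>2)"

text \<open>The measure \<open>e\<^sup>-\<^sup>\<psi> dx\<close> on \<open>I\<close>, regarded as a Borel measure on the whole line that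
  vanishes outside \<open>I\<close>; the values of \<open>\<psi>\<close> outside \<open>I\<close> play no role.\<close>

definition exp_measure :: "real set \<Rightarrow> (real \<Rightarrow> real) \<Rightarrow> real measure" where
  "exp_measure I \<psi> = density lborel (\<lambda>x. ennreal (exp (- \<psi> x)) * indicator I x)"

definition gauss_potential :: "real \<Rightarrow> real" where
  "gauss_potential x = x\<^sup>2 / 2 + 1 / 2 * ln (2 * pi)"

lemma exp_gauss_potential: "exp (- gauss_potential x) = std_normal_density x"
proof -
  have "exp (1 / 2 * ln (2 * pi)) = sqrt (2 * pi)"
    by (simp add: powr_half_sqrt[symmetric] powr_def)
  moreover have "exp (- gauss_potential x) = exp (- x\<^sup>2 / 2) / exp (1 / 2 * ln (2 * pi))"
    unfolding exp_diff[symmetric] by (rule arg_cong[of _ _ exp]) (simp add: gauss_potential_def)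
  ultimately show ?thesis
    by (simp only: std_normal_density_def) simp
qed

definition gauss_quantile :: "real \<Rightarrow> real" where
  "gauss_quantile \<theta> = (THE a. measure std_normal_distribution {..a} = \<theta>)"

lemma measure_std_normal_gauss_quantile:
  assumes "0 < \<theta>" "\<theta> < 1"
  shows "measure std_normal_distribution {..gauss_quantile \<theta>} = \<theta>"
proof -
  let ?F = "cdf std_normal_distribution"
  interpret real_distribution std_normal_distribution
    by (rule real_dist_normal_dist)
  have null: "measure std_normal_distribution {x} = 0" for x
  proof -
    have "AE y in lborel. y \<in> {x} \<longrightarrow> ennreal (std_normal_density y) = 0"
      using AE_lborel_singleton[of x] by eventually_elim auto
    then have "{x} \<in> null_sets std_normal_distribution"
      by (subst null_sets_density_iff) auto
    then show ?thesis by (simp add: measure_eq_0_null_sets)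
  qed
  have cont: "isCont ?F x" for x
    using null[of x] by (simp add: isCont_cdf)
  have pos: "?F a < ?F b" if "a < b" for a b
  proof -
    have "measure std_normal_distribution {a<..b} \<noteq> 0"
    proof
      assume "measure std_normal_distribution {a<..b} = 0"
      then have "emeasure std_normal_distribution {a<..b} = 0"
        by (simp add: emeasure_eq_measure)
      then have "AE x in lborel. ennreal (std_normal_density x) * indicator {a<..b} x = 0"
        by (simp add: emeasure_density nn_integral_0_iff_AE del: mult_eq_0_iff)
      then have "AE x in lborel. x \<notin> {a<..b}"
      proof (rule AE_mp, intro AE_I2 impI)
        fix x :: real
        assume "ennreal (std_normal_density x) * indicator {a<..b} x = 0"
        moreover have "0 < std_normal_density x" by (simp add: normal_density_pos)
        ultimately show "x \<notin> {a<..b}" by (auto simp: indicator_def)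
      qed
      then have "emeasure lborel {a<..b} = 0"
        using AE_iff_null_sets[of "{a<..b}" "lborel :: real measure"] by (simp add: null_sets_def)
      then show False using that by simp
    qed
    then have "measure std_normal_distribution {a<..b} > 0"
      using measure_nonneg[of std_normal_distribution "{a<..b}"] by linarith
    with cdf_diff_eq[OF that] show ?thesis by linarith
  qed
  obtain l where l: "?F l < \<theta>"
    using order_tendstoD(2)[OF cdf_lim_at_bot assms(1)] unfolding eventually_at_bot_linorder by blast
  obtain u where u: "\<theta> < ?F u"
    using order_tendstoD(1)[OF cdf_lim_at_top_prob assms(2)] unfolding eventually_at_top_linorder by blast
  have "l \<le> u" using l u pos[of u l] by linarith
  then obtain a where a: "?F a = \<theta>"
    using IVT[of ?F l \<theta> u] l u cont by auto
  moreover have "b = a" if "?F b = \<theta>" for b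
    using that a pos[of a b] pos[of b a] by linarith
  ultimately have "\<exists>!a. ?F a = \<theta>" by blast
  from theI'[OF this] show ?thesis
    by (simp add: gauss_quantile_def cdf_def)
qed

definition couplings :: "real measure \<Rightarrow> real measure \<Rightarrow> (real \<times> real) measure set" where
  "couplings \<mu> \<nu> =
    {\<pi>. prob_space \<pi> \<and> sets \<pi> = sets (borel \<Otimes>\<^sub>M borel)
        \<and> distr \<pi> borel fst = \<mu> \<and> distr \<pi> borel snd = \<nu>}"

definition ennreal_sqrt :: "ennreal \<Rightarrow> ennreal" where
  "ennreal_sqrt x = (if x = \<infinity> then \<infinity> else ennreal (sqrt (enn2real x)))"

text \<open>The distance is valued in \<open>[0, \<infinity>]\<close>, so a finite upper bound on it carries
  the finiteness of the transport cost.\<close>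

definition W2 :: "real measure \<Rightarrow> real measure \<Rightarrow> ennreal" where
  "W2 \<mu> \<nu> =
    (INF \<pi>\<in>couplings \<mu> \<nu>. ennreal_sqrt (\<integral>\<^sup>+ (x, y). ennreal (\<bar>x - y\<bar>\<^sup>2) \<partial>\<pi>))"

end

theory Submission
  imports Defs
begin

text \<open>
  Write \<open>f = e\<^sup>-\<^sup>h g\<close> for the density of \<open>m\<close>, with \<open>g\<close> the Gaussian density and \<open>h\<close> convex,
  and let \<open>a\<close> be the common \<open>\<theta>\<close>-quantile. The hypothesis bounds \<open>- h a\<close> by a multiple of \<open>\<delta>\<close>; as
  \<open>m\<close> and the Gaussian agree on both half-lines bounded by \<open>a\<close>, a supporting line of \<open>h\<close> at \<open>a\<close>
  has slope of order \<open>\<delta>\<close>, whence \<open>- h x \<le> K \<delta> (1 + \<bar>x - a\<bar>)\<close>.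

  Let \<open>S\<close> be the increasing transport map from \<open>m\<close> to the Gaussian, so that \<open>S' = f / g(S)\<close>. As in
  the transport proof of Talagrand's inequality, \<open>ln S' \<ge> 1 - 1 / S'\<close> yields
  \<open>f (x - S)\<^sup>2 / 2 \<le> - h f + ((x - S) g(S))'\<close>. Convexity of \<open>h\<close> forces \<open>S x \<ge> x\<close> to the right of
  \<open>a\<close> and \<open>S x \<le> x\<close> to its left, so the boundary terms have the good sign, and integration bounds
  the transport cost by a multiple of \<open>\<delta>\<close>.
\<close>

section \<open>Distribution functions of measures with a density\<close>

lemma nn_integral_continuous_Icc:
  fixes f :: "real \<Rightarrow> real"
  assumes cont: "continuous_on {a..b} f" and nonneg: "\<And>x. x \<in> {a..b} \<Longrightarrow> 0 \<le> f x"
  shows "(\<integral>\<^sup>+x\<in>{a..b}. ennreal (f x) \<partial>lborel) = ennreal (integral {a..b} f)"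
proof -
  let ?g = "\<lambda>x. if x \<in> {a..b} then f x else 0"
  have "(?g has_integral integral {a..b} f) UNIV"
    unfolding has_integral_restrict_UNIV
    by (rule integrable_integral[OF integrable_continuous_real[OF cont]])
  moreover have "?g \<in> borel_measurable borel"
    by (intro borel_measurable_continuous_on_if cont) auto
  ultimately have "(\<integral>\<^sup>+x. ennreal (?g x) \<partial>lborel) = ennreal (integral {a..b} f)"
    using nonneg by (intro nn_integral_has_integral_lborel) auto
  moreover have "(\<integral>\<^sup>+x. ennreal (?g x) \<partial>lborel) = (\<integral>\<^sup>+x\<in>{a..b}. ennreal (f x) \<partial>lborel)"
    by (intro nn_integral_cong) (auto split: split_indicator)
  ultimately show ?thesis by simp
qed

text \<open>Near \<open>x\<close> the cdf is a constant plus the integral of \<open>f\<close> from a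
  fixed left endpoint, so the fundamental theorem of calculus applies. Continuity is asked only on a
  neighbourhood because the density of \<open>m\<close> may jump at the ends of
  \<open>I\<close>.\<close>

lemma cdf_density_has_real_derivative:
  fixes f :: "real \<Rightarrow> real"
  assumes prob: "real_distribution (density lborel (\<lambda>x. ennreal (f x)))"
    and [measurable]: "f \<in> borel_measurable borel" and nonneg: "\<And>x. 0 \<le> f x"
    and U: "open U" "x \<in> U" "continuous_on U f"
  shows "(cdf (density lborel (\<lambda>x. ennreal (f x))) has_real_derivative f x) (at x)"
proof -
  let ?M = "density lborel (\<lambda>x. ennreal (f x))"
  interpret real_distribution ?M by (rule prob)
  obtain e where e: "0 < e" "cball x e \<subseteq> U"
    using U open_contains_cball by blast
  define l r where "l = x - e" and "r = x + e"
  have lr: "l < x" "x < r" "{l..r} \<subseteq> U"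
    using e by (auto simp: l_def r_def cball_eq_atLeastAtMost)
  have cont: "continuous_on {l..r} f"
    using U(3) lr(3) continuous_on_subset by blast
  have eq: "cdf ?M y = measure ?M {..l} + integral {l..y} f" if "y \<in> {l<..<r}" for y
  proof -
    have cy: "continuous_on {l..y} f"
      using cont that by (auto intro: continuous_on_subset)
    have "emeasure ?M {l<..y} = (\<integral>\<^sup>+x. ennreal (f x) * indicator {l<..y} x \<partial>lborel)"
      by (simp add: emeasure_density)
    also have "\<dots> = (\<integral>\<^sup>+x\<in>{l..y}. ennreal (f x) \<partial>lborel)"
      using AE_lborel_singleton[of l]
      by (intro nn_integral_cong_AE, eventually_elim) (auto split: split_indicator)
    also have "\<dots> = ennreal (integral {l..y} f)"
      using cy nonneg by (intro nn_integral_continuous_Icc) auto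
    finally have "measure ?M {l<..y} = integral {l..y} f"
      using nonneg by (simp add: measure_def integral_nonneg integrable_continuous_real cy)
    with cdf_diff_eq[of l y] that show ?thesis by (simp add: cdf_def)
  qed
  have "((\<lambda>y. measure ?M {..l} + integral {l..y} f) has_real_derivative f x) (at x within {l..r})"
    using integral_has_real_derivative[OF cont, of x] lr
    by (auto intro!: derivative_eq_intros)
  then have "((\<lambda>y. measure ?M {..l} + integral {l..y} f) has_real_derivative f x) (at x within {l<..<r})"
    by (rule has_field_derivative_subset) auto
  then have "((\<lambda>y. measure ?M {..l} + integral {l..y} f) has_real_derivative f x) (at x)"
    using lr at_within_open[of x "{l<..<r}"] by simp
  then show ?thesis
    by (rule has_field_derivative_transform_within_open[of _ _ _ "{l<..<r}"]) (use lr eq in auto)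
qed

section \<open>The Gaussian distribution function and its inverse; comparison of densities\<close>

abbreviation gauss_cdf :: "real \<Rightarrow> real" where
  "gauss_cdf \<equiv> cdf std_normal_distribution"

lemma gauss_cdf_has_real_derivative:
  "(gauss_cdf has_real_derivative std_normal_density x) (at x)"
  by (rule cdf_density_has_real_derivative[OF real_dist_normal_dist, of UNIV])
    (auto simp: normal_density_def intro!: continuous_intros)

lemma gauss_cdf_strict_mono: "x < y \<Longrightarrow> gauss_cdf x < gauss_cdf y"
  by (rule DERIV_pos_imp_increasing)
    (use gauss_cdf_has_real_derivative normal_density_pos in \<open>auto intro!: exI\<close>)

lemma gauss_cdf_less_iff: "gauss_cdf x < gauss_cdf y \<longleftrightarrow> x < y"
  using gauss_cdf_strict_mono[of x y] gauss_cdf_strict_mono[of y x] by (cases x y rule: linorder_cases) auto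

lemma gauss_cdf_le_iff: "gauss_cdf x \<le> gauss_cdf y \<longleftrightarrow> x \<le> y"
  using gauss_cdf_less_iff[of y x] by linarith

lemma gauss_cdf_bounds: "0 < gauss_cdf x" "gauss_cdf x < 1"
proof -
  interpret real_distribution std_normal_distribution by (rule real_dist_normal_dist)
  show "0 < gauss_cdf x"
    using gauss_cdf_strict_mono[of "x - 1" x] cdf_nonneg[of "x - 1"] by linarith
  show "gauss_cdf x < 1"
    using gauss_cdf_strict_mono[of x "x + 1"] cdf_bounded_prob[of "x + 1"] by linarith
qed

lemma gauss_cdf_quantile: "0 < u \<Longrightarrow> u < 1 \<Longrightarrow> gauss_cdf (gauss_quantile u) = u"
  using measure_std_normal_gauss_quantile by (simp add: cdf_def)

lemma gauss_quantile_cdf: "gauss_quantile (gauss_cdf x) = x"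
  using gauss_cdf_quantile[OF gauss_cdf_bounds[of x]] gauss_cdf_less_iff
  by (metis linorder_neqE order_less_irrefl)

lemma gauss_quantile_has_real_derivative:
  assumes "0 < u" "u < 1"
  shows "(gauss_quantile has_real_derivative inverse (std_normal_density (gauss_quantile u))) (at u)"
proof (rule DERIV_inverse_function)
  show "(gauss_cdf has_real_derivative std_normal_density (gauss_quantile u)) (at (gauss_quantile u))"
    by (rule gauss_cdf_has_real_derivative)
  show "std_normal_density (gauss_quantile u) \<noteq> 0"
    using normal_density_pos[of 1 0 "gauss_quantile u"] by simp
  \<comment> \<open>The radius \<open>1\<close> is arbitrary, as \<open>gauss_quantile\<close>
    inverts \<open>gauss_cdf\<close> on the whole line.\<close>
  have "isCont gauss_quantile (gauss_cdf (gauss_quantile u))"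
    by (rule isCont_inverse_function[of 1])
      (auto simp: gauss_quantile_cdf intro: DERIV_isCont gauss_cdf_has_real_derivative)
  then show "isCont gauss_quantile u"
    using assms by (simp add: gauss_cdf_quantile)
qed (use assms gauss_cdf_quantile in auto)

lemma measure_density_le:
  fixes f g :: "real \<Rightarrow> real"
  assumes fin: "finite_measure (density lborel (\<lambda>x. ennreal (f x)))"
      "finite_measure (density lborel (\<lambda>x. ennreal (g x)))"
    and [measurable]: "f \<in> borel_measurable borel" "g \<in> borel_measurable borel" "A \<in> sets borel"
    and c: "0 \<le> c" and le: "\<And>x. x \<in> A \<Longrightarrow> f x \<le> c * g x"
  shows "measure (density lborel (\<lambda>x. ennreal (f x))) A \<le> c * measure (density lborel (\<lambda>x. ennreal (g x))) A"
proof -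
  interpret f: finite_measure "density lborel (\<lambda>x. ennreal (f x))" by (rule fin)
  interpret g: finite_measure "density lborel (\<lambda>x. ennreal (g x))" by (rule fin)
  have "emeasure (density lborel (\<lambda>x. ennreal (f x))) A
      \<le> (\<integral>\<^sup>+x. ennreal c * (ennreal (g x) * indicator A x) \<partial>lborel)"
    using le c
    by (subst emeasure_density)
      (auto intro!: nn_integral_mono ennreal_leI simp flip: ennreal_mult' split: split_indicator)
  also have "\<dots> = ennreal c * emeasure (density lborel (\<lambda>x. ennreal (g x))) A"
    by (simp add: nn_integral_cmult emeasure_density)
  finally show ?thesis
    using c by (simp add: f.emeasure_eq_measure g.emeasure_eq_measure flip: ennreal_mult)
qed

lemma std_normal_density_has_real_derivative [derivative_intros]:
  "(std_normal_density has_real_derivative - x * std_normal_density x) (at x)"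
  unfolding std_normal_density_def[abs_def] by (auto intro!: derivative_eq_intros simp: field_simps)

lemma measure_greaterThan:
  assumes "real_distribution N"
  shows "measure N {x<..} = 1 - cdf N x"
proof -
  interpret real_distribution N by (rule assms)
  have "{x<..} = space N - {..x}" by auto
  then show ?thesis using prob_compl[of "{..x}"] by (simp add: cdf_def)
qed

section \<open>One-convex measures: relative potential and distribution function\<close>

locale one_convex_prob =
  fixes I :: "real set" and \<psi> :: "real \<Rightarrow> real"
  assumes open_I: "open I" and interval_I: "is_interval I"
    and one_convex: "one_convex_on I \<psi>" and prob: "prob_space (exp_measure I \<psi>)"
begin

abbreviation m :: "real measure" where
  "m \<equiv> exp_measure I \<psi>"

definition f :: "real \<Rightarrow> real" where
  "f x = (if x \<in> I then exp (- \<psi> x) else 0)"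

text \<open>On \<open>I\<close> this is minus the logarithm of the density of \<open>m\<close>
  relative to the Gaussian.\<close>

definition h :: "real \<Rightarrow> real" where
  "h x = \<psi> x - gauss_potential x"

text \<open>The Gaussian potential satisfies the inequality of one-convexity with equality, so
  subtracting it cancels the quadratic term exactly.\<close>

lemma convex_h: "convex_on I h"
proof (rule convex_onI)
  show "convex I" using interval_I by (simp add: is_interval_convex)
  fix t x y :: real assume *: "0 < t" "t < 1" "x \<in> I" "y \<in> I"
  have "\<psi> ((1 - t) * x + t * y)
      \<le> (1 - t) * \<psi> x + t * \<psi> y - 1 / 2 * (1 - t) * t * \<bar>x - y\<bar>\<^sup>2"
    using one_convex * unfolding one_convex_on_def by simp
  moreover have "gauss_potential ((1 - t) * x + t * y)
      = (1 - t) * gauss_potential x + t * gauss_potential y - 1 / 2 * (1 - t) * t * \<bar>x - y\<bar>\<^sup>2"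
    by (simp add: gauss_potential_def power2_eq_square field_simps)
  ultimately show "h ((1 - t) *\<^sub>R x + t *\<^sub>R y) \<le> (1 - t) * h x + t * h y"
    by (simp add: h_def algebra_simps)
qed

lemma f_eq: "x \<in> I \<Longrightarrow> f x = exp (- h x) * std_normal_density x"
  by (simp add: f_def h_def exp_gauss_potential[symmetric] flip: exp_add)

lemma f_nonneg: "0 \<le> f x" and f_pos: "x \<in> I \<Longrightarrow> 0 < f x"
  by (simp_all add: f_def)

lemma continuous_on_h: "continuous_on I h"
  by (rule convex_on_continuous[OF open_I convex_h])

lemma continuous_on_f: "continuous_on I f"
  by (subst continuous_on_cong[OF refl f_eq])
    (auto simp: normal_density_def intro!: continuous_intros continuous_on_h)

lemma f_measurable [measurable]: "f \<in> borel_measurable borel"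
proof -
  have "(\<lambda>x. if x \<in> I then f x else 0) \<in> borel_measurable borel"
    using open_I continuous_on_f by (intro borel_measurable_continuous_on_if) auto
  also have "(\<lambda>x. if x \<in> I then f x else 0) = f"
    by (auto simp: f_def)
  finally show ?thesis .
qed

lemma m_eq: "m = density lborel (\<lambda>x. ennreal (f x))"
  unfolding exp_measure_def by (rule arg_cong[of _ _ "density lborel"]) (auto simp: f_def)

lemma real_distribution_m: "real_distribution m"
  using prob by (simp add: real_distribution_def real_distribution_axioms_def exp_measure_def)

sublocale M: real_distribution m by (rule real_distribution_m)

lemma AE_I: "AE x in m. x \<in> I"
  unfolding m_eq by (subst AE_density, measurable) (auto simp: f_def)

lemma cdf_has_real_derivative: "x \<in> I \<Longrightarrow> (cdf m has_real_derivative f x) (at x)"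
  using cdf_density_has_real_derivative[of f I x] real_distribution_m open_I f_nonneg continuous_on_f
  by (simp add: m_eq)

lemma isCont_cdf: "isCont (cdf m) x"
proof -
  have "AE y in lborel. y \<in> {x} \<longrightarrow> ennreal (f y) = 0"
    using AE_lborel_singleton[of x] by eventually_elim auto
  then have "{x} \<in> null_sets m"
    unfolding m_eq by (subst null_sets_density_iff) auto
  then show ?thesis by (simp add: M.isCont_cdf measure_eq_0_null_sets)
qed

lemma cdf_strict_mono:
  assumes "x \<in> I" "y \<in> I" "x < y"
  shows "cdf m x < cdf m y"
  using \<open>x < y\<close>
proof (rule DERIV_pos_imp_increasing)
  fix z assume "x \<le> z" "z \<le> y"
  then have "z \<in> I" using assms interval_I by (meson mem_is_interval_1_I)
  then show "\<exists>d. DERIV (cdf m) z :> d \<and> 0 < d"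
    using cdf_has_real_derivative f_pos by blast
qed

lemma cdf_bounds:
  assumes "x \<in> I"
  shows "0 < cdf m x" "cdf m x < 1"
proof -
  obtain e where e: "0 < e" "cball x e \<subseteq> I"
    using assms open_I open_contains_cball by blast
  then have "x - e \<in> I" "x + e \<in> I"
    by (auto simp: cball_eq_atLeastAtMost)
  then show "0 < cdf m x" "cdf m x < 1"
    using cdf_strict_mono[of "x - e" x] cdf_strict_mono[of x "x + e"] assms e
      M.cdf_nonneg[of "x - e"] M.cdf_bounded_prob[of "x + e"] by auto
qed

text \<open>A point off the interval has all of \<open>I\<close> on one side, and \<open>m\<close>
  is concentrated on \<open>I\<close>, so the cdf there is \<open>0\<close> or
  \<open>1\<close>.\<close>

lemma mem_I:
  assumes "0 < cdf m x" "cdf m x < 1"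
  shows "x \<in> I"
proof (rule ccontr)
  assume "x \<notin> I"
  then consider "\<forall>y\<in>I. y \<le> x" | "\<forall>y\<in>I. x < y"
    using mem_is_interval_1_I[OF interval_I] by (meson linorder_le_less_linear less_imp_le)
  then show False
  proof cases
    case 1
    then have "AE y in m. y \<in> {..x}" using AE_I by auto
    then show False using assms M.prob_eq_1[of "{..x}"] by (simp add: cdf_def)
  next
    case 2
    then have "AE y in m. y \<notin> {..x}" using AE_I by (auto elim!: eventually_mono)
    then show False using assms M.prob_eq_0[of "{..x}"] by (simp add: cdf_def)
  qed
qed

lemma cdf_surj:
  assumes "0 < u" "u < 1"
  obtains x where "x \<in> I" "cdf m x = u"
proof -
  obtain l where l: "cdf m l < u"
    using order_tendstoD(2)[OF M.cdf_lim_at_bot assms(1)]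
    unfolding eventually_at_bot_linorder by blast
  obtain r where r: "u < cdf m r"
    using order_tendstoD(1)[OF M.cdf_lim_at_top_prob assms(2)]
    unfolding eventually_at_top_linorder by blast
  have "l \<le> r" using l r M.cdf_nondecreasing[of r l] by linarith
  then obtain x where "cdf m x = u"
    using IVT[of "cdf m" l u r] l r isCont_cdf by auto
  with assms mem_I that show thesis by blast
qed

section \<open>The monotone transport map and its coupling\<close>

text \<open>The increasing transport map from \<open>m\<close> to the Gaussian; the value \<open>0\<close> off \<open>I\<close> is junk.\<close>

definition S :: "real \<Rightarrow> real" where
  "S x = (if x \<in> I then gauss_quantile (cdf m x) else 0)"

lemma gauss_cdf_S: "x \<in> I \<Longrightarrow> gauss_cdf (S x) = cdf m x"
  by (simp add: S_def gauss_cdf_quantile cdf_bounds)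

lemma S_has_real_derivative:
  assumes "x \<in> I"
  shows "(S has_real_derivative f x / std_normal_density (S x)) (at x)"
proof -
  have "((\<lambda>x. gauss_quantile (cdf m x)) has_real_derivative
      inverse (std_normal_density (gauss_quantile (cdf m x))) * f x) (at x)"
    using assms
    by (intro DERIV_chain2[OF gauss_quantile_has_real_derivative cdf_has_real_derivative] cdf_bounds)
  then have "((\<lambda>x. gauss_quantile (cdf m x)) has_real_derivative
      f x / std_normal_density (S x)) (at x)"
    using assms by (simp add: S_def field_simps)
  then show ?thesis
    by (rule has_field_derivative_transform_within_open[OF _ open_I assms]) (simp add: S_def)
qed

lemma continuous_on_S: "continuous_on I S"
  by (meson DERIV_isCont S_has_real_derivative continuous_at_imp_continuous_on)

lemma S_measurable [measurable]: "S \<in> borel_measurable borel"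
proof -
  have "(\<lambda>x. if x \<in> I then S x else 0) \<in> borel_measurable borel"
    using open_I continuous_on_S by (intro borel_measurable_continuous_on_if) auto
  also have "(\<lambda>x. if x \<in> I then S x else 0) = S"
    by (auto simp: S_def)
  finally show ?thesis .
qed

text \<open>Two laws with the same cdf coincide. For given \<open>t\<close> choose \<open>x\<close>
  in \<open>I\<close> with \<open>cdf m x = gauss_cdf t\<close>; monotonicity turns the event
  \<open>S y \<le> t\<close> into \<open>y \<le> x\<close>.\<close>

lemma distr_S: "distr m borel S = std_normal_distribution"
proof (rule cdf_unique)
  show "real_distribution (distr m borel S)"
    by (simp add: real_distribution_def real_distribution_axioms_def M.prob_space_distr)
  show "real_distribution std_normal_distribution" by (rule real_dist_normal_dist)
  show "cdf (distr m borel S) = gauss_cdf"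
  proof
    fix t
    obtain x where x: "x \<in> I" "cdf m x = gauss_cdf t"
      using cdf_surj gauss_cdf_bounds by blast
    have "S y \<le> t \<longleftrightarrow> y \<le> x" if "y \<in> I" for y
    proof -
      have "S y \<le> t \<longleftrightarrow> cdf m y \<le> cdf m x"
        unfolding gauss_cdf_S[OF that, symmetric] x(2) by (simp add: gauss_cdf_le_iff)
      also have "\<dots> \<longleftrightarrow> y \<le> x"
        using cdf_strict_mono[of x y] M.cdf_nondecreasing[of y x] that x by fastforce
      finally show ?thesis .
    qed
    then have "measure m (S -` {..t} \<inter> space m) = measure m {..x}"
      using AE_I by (intro M.finite_measure_eq_AE)
        (auto elim!: eventually_mono intro: measurable_sets_borel[OF S_measurable])
    then show "cdf (distr m borel S) t = gauss_cdf t"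
      using x by (simp add: cdf_def measure_distr)
  qed
qed

text \<open>The law of \<open>(x, S x)\<close> under \<open>m\<close> is an admissible coupling, so
  its cost bounds the infimum.\<close>

lemma W2_le: "W2 m std_normal_distribution \<le> ennreal_sqrt (\<integral>\<^sup>+x. ennreal ((x - S x)\<^sup>2) \<partial>m)"
proof -
  let ?\<pi> = "distr m (borel \<Otimes>\<^sub>M borel) (\<lambda>x. (x, S x))"
  have "?\<pi> \<in> couplings m std_normal_distribution"
    unfolding couplings_def
    using distr_S by (auto simp: distr_distr comp_def distr_id2 intro!: M.prob_space_distr)
  then have "W2 m std_normal_distribution \<le> ennreal_sqrt (\<integral>\<^sup>+(x, y). ennreal (\<bar>x - y\<bar>\<^sup>2) \<partial>?\<pi>)"
    unfolding W2_def by (rule INF_lower)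
  also have "(\<integral>\<^sup>+(x, y). ennreal (\<bar>x - y\<bar>\<^sup>2) \<partial>?\<pi>) = (\<integral>\<^sup>+x. ennreal ((x - S x)\<^sup>2) \<partial>m)"
    by (subst nn_integral_distr) auto
  finally show ?thesis .
qed

section \<open>Mass comparison with the Gaussian and the order of \<open>S x\<close> and
  \<open>x\<close>\<close>

lemma measure_m_le:
  assumes "A \<in> sets borel" "0 \<le> c" "\<And>x. x \<in> A \<Longrightarrow> f x \<le> c * std_normal_density x"
  shows "measure m A \<le> c * measure std_normal_distribution A"
proof -
  interpret G: real_distribution std_normal_distribution by (rule real_dist_normal_dist)
  show ?thesis
    unfolding m_eq
    by (rule measure_density_le)
      (use assms M.finite_measure_axioms G.finite_measure_axioms in \<open>auto simp: m_eq\<close>)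
qed

text \<open>A convex \<open>h\<close> with \<open>h > 0\<close> at a point of \<open>H1\<close> and \<open>h < 0\<close> at a point of \<open>H2\<close> is bounded
  below by a positive constant on \<open>H0\<close>, so that \<open>m\<close> gives \<open>H0\<close> less mass than the Gaussian.\<close>

lemma measure_le_of_between:
  assumes [measurable]: "H0 \<in> sets borel" "H1 \<in> sets borel" "H2 \<in> sets borel"
    and disj: "H0 \<inter> H1 = {}" "(H0 \<union> H1) \<inter> H2 = {}" and univ: "H0 \<union> H1 \<union> H2 = UNIV"
    and between: "\<And>x0 x1 x2. x0 \<in> H0 \<Longrightarrow> x1 \<in> H1 \<Longrightarrow> x2 \<in> H2 \<Longrightarrow>
      x1 \<in> open_segment x0 x2"
    and H0: "measure m H0 = measure std_normal_distribution H0" "0 < measure std_normal_distribution H0"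
  shows "measure m H2 \<le> measure std_normal_distribution H2"
proof (rule ccontr)
  let ?\<gamma> = std_normal_distribution
  interpret G: real_distribution ?\<gamma> by (rule real_dist_normal_dist)
  assume *: "\<not> measure m H2 \<le> measure ?\<gamma> H2"
  have total: "measure N H0 + measure N H1 + measure N H2 = 1" if "real_distribution N" for N
  proof -
    interpret real_distribution N by (rule that)
    have "prob H0 + prob H1 + prob H2 = prob (H0 \<union> H1 \<union> H2)"
      using disj by (simp add: finite_measure_Union)
    then show ?thesis using prob_space by (simp add: univ)
  qed
  \<comment> \<open>Equality on \<open>H0\<close> and an excess on \<open>H2\<close> force a deficit
    on \<open>H1\<close>; hence there are points where the densities compare strictly, in opposite
    directions.\<close>
  have "measure m H1 < measure ?\<gamma> H1"
    using total[OF real_distribution_m] total[OF real_dist_normal_dist] * H0(1) by linarith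
  moreover have "measure ?\<gamma> H1 \<le> 1 * measure m H1" if "\<And>x. x \<in> H1 \<Longrightarrow> std_normal_density x \<le> f x"
    unfolding m_eq
    using that M.finite_measure_axioms G.finite_measure_axioms
    by (intro measure_density_le) (auto simp: m_eq)
  ultimately obtain x1 where x1: "x1 \<in> H1" "f x1 < std_normal_density x1"
    by fastforce
  obtain x2 where x2: "x2 \<in> H2" "std_normal_density x2 < f x2"
    using * measure_m_le[of H2 1] by fastforce
  then have x2I: "x2 \<in> I"
    using normal_density_pos[of 1 0 x2] by (auto simp: f_def split: if_splits)
  then have hx2: "h x2 < 0"
    using x2(2) normal_density_pos[of 1 0 x2] by (simp add: f_eq)
  \<comment> \<open>The constant is \<open>0\<close> when \<open>x1\<close> is outside
    \<open>I\<close>: then no point of \<open>H0\<close> is in \<open>I\<close>, because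
    \<open>x1\<close> lies between it and the point \<open>x2\<close> of \<open>I\<close>.\<close>
  have "f x0 \<le> (if x1 \<in> I then exp (- h x1) else 0) * std_normal_density x0" if x0: "x0 \<in> H0" for x0
  proof (cases "x0 \<in> I")
    case True
    obtain t where t: "0 < t" "t < 1" "x1 = (1 - t) * x0 + t * x2"
      using between[OF x0 x1(1) x2(1)] by (auto simp: in_segment)
    have x1I: "x1 \<in> I"
      using convexD[of I x0 x2 "1 - t" t] interval_I t True x2I by (simp add: is_interval_convex)
    have "h x1 > 0"
      using x1(2) normal_density_pos[of 1 0 x1] by (simp add: f_eq x1I)
    moreover have "h x1 \<le> (1 - t) * h x0 + t * h x2"
      using convex_onD[OF convex_h, of t x0 x2] t True x2I by simp
    moreover have "t * h x2 < 0" using t hx2 by (simp add: mult_pos_neg)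
    ultimately have "h x1 \<le> (1 - t) * h x0" "0 < (1 - t) * h x0" by linarith+
    moreover from this(2) have "0 < h x0" using t by (simp add: zero_less_mult_iff)
    then have "(1 - t) * h x0 \<le> h x0" using t by (simp add: algebra_simps)
    ultimately have "h x1 \<le> h x0" by linarith
    then show ?thesis using True x1I by (simp add: f_eq mult_right_mono)
  qed (simp add: f_def)
  then have "measure m H0 \<le> (if x1 \<in> I then exp (- h x1) else 0) * measure ?\<gamma> H0"
    by (intro measure_m_le) auto
  also have "\<dots> < 1 * measure ?\<gamma> H0"
    using x1(2) normal_density_pos[of 1 0 x1] H0(2)
    by (intro mult_strict_right_mono) (auto simp: f_eq)
  finally show False using H0(1) by simp
qed

end

locale one_convex_prob_quantile = one_convex_prob +
  fixes a :: real
  assumes cdf_a: "cdf m a = gauss_cdf a"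
begin

lemma a_mem: "a \<in> I"
  by (rule mem_I) (simp_all add: cdf_a gauss_cdf_bounds)

text \<open>Taking the half-line left of \<open>a\<close> as the set of equal mass, the tail of
  \<open>m\<close> beyond \<open>x\<close> is no heavier than the Gaussian one, so the Gaussian
  reaches the value \<open>cdf m x\<close> no earlier than at \<open>x\<close>.\<close>

lemma S_ge: "x \<in> I \<Longrightarrow> a \<le> x \<Longrightarrow> x \<le> S x"
proof -
  assume x: "x \<in> I" "a \<le> x"
  have "measure m {x<..} \<le> measure std_normal_distribution {x<..}"
  proof (rule measure_le_of_between[of "{..a}" "{a<..x}"])
    fix x0 x1 x2 assume "x0 \<in> {..a}" "x1 \<in> {a<..x}" "x2 \<in> {x<..}"
    then show "x1 \<in> open_segment x0 x2"
      by (auto simp: open_segment_eq_real_ivl)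
  qed (use x cdf_a gauss_cdf_bounds in \<open>auto simp: cdf_def\<close>)
  then have "gauss_cdf x \<le> gauss_cdf (S x)"
    using x by (simp add: measure_greaterThan real_distribution_m real_dist_normal_dist gauss_cdf_S)
  then show "x \<le> S x" by (simp add: gauss_cdf_le_iff)
qed

text \<open>The mirror image, with the half-line right of \<open>a\<close> as the set of equal
  mass.\<close>

lemma S_le: "x \<in> I \<Longrightarrow> x \<le> a \<Longrightarrow> S x \<le> x"
proof -
  assume x: "x \<in> I" "x \<le> a"
  have "measure m {..x} \<le> measure std_normal_distribution {..x}"
  proof (rule measure_le_of_between[of "{a<..}" "{x<..a}"])
    fix x0 x1 x2 assume "x0 \<in> {a<..}" "x1 \<in> {x<..a}" "x2 \<in> {..x}"
    then show "x1 \<in> open_segment x0 x2"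
      by (auto simp: open_segment_eq_real_ivl)
  qed (use x cdf_a gauss_cdf_bounds in
      \<open>auto simp: measure_greaterThan real_distribution_m real_dist_normal_dist\<close>)
  then have "gauss_cdf (S x) \<le> gauss_cdf x"
    unfolding gauss_cdf_S[OF x(1)] by (simp add: cdf_def)
  then show "S x \<le> x" by (simp add: gauss_cdf_le_iff)
qed

section \<open>Bounding the transport cost by the relative potential\<close>

text \<open>The bracket is the derivative of \<open>(x - S x) g(S x)\<close>, since \<open>S' = f / g(S)\<close>.\<close>

lemma energy_density_le:
  assumes x: "x \<in> I" and k: "- h x \<le> k"
  shows "f x * (x - S x)\<^sup>2 / 2
    \<le> k * f x + (std_normal_density (S x) - f x - S x * (x - S x) * f x)"
proof -
  \<comment> \<open>\<open>?D\<close> is the derivative of \<open>S\<close> at \<open>x\<close>. Its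
    logarithm appears below as \<open>- ln (1 / ?D)\<close>, ready for
    \<open>ln y \<le> y - 1\<close> at \<open>y = 1 / ?D\<close>.\<close>
  let ?D = "f x / std_normal_density (S x)"
  have pos: "0 < f x" "0 < std_normal_density (S x)"
    using x by (simp_all add: f_pos normal_density_pos)
  have "?D = exp (- h x - gauss_potential x + gauss_potential (S x))"
    using x by (simp add: f_eq exp_diff exp_add flip: exp_gauss_potential) (simp add: exp_minus field_simps)
  then have "- ln (1 / ?D) = - h x - gauss_potential x + gauss_potential (S x)"
    using pos by (simp add: ln_div)
  moreover have "ln (1 / ?D) \<le> 1 / ?D - 1"
    using pos by (intro ln_le_minus_one) simp
  ultimately have "1 - 1 / ?D + (x\<^sup>2 - (S x)\<^sup>2) / 2 \<le> k"
    using k by (simp add: gauss_potential_def diff_divide_distrib)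
  then have "(1 - 1 / ?D + (x\<^sup>2 - (S x)\<^sup>2) / 2) * f x \<le> k * f x"
    using pos by (intro mult_right_mono) auto
  moreover have "(1 - 1 / ?D + (x\<^sup>2 - (S x)\<^sup>2) / 2) * f x
      = f x - std_normal_density (S x) + (x\<^sup>2 - (S x)\<^sup>2) / 2 * f x"
    using pos by (simp add: algebra_simps)
  \<comment> \<open>The square comes from \<open>(x\<^sup>2 - (S x)\<^sup>2) / 2 = (x - S x)\<^sup>2
    / 2 + S x * (x - S x)\<close>.\<close>
  ultimately show ?thesis
    by (simp add: power2_eq_square field_simps)
qed

lemma energy_Icc_le:
  assumes lr: "l \<in> I" "r \<in> I" "l \<le> a" "a \<le> r"
    and k: "continuous_on UNIV k" "\<And>x. 0 \<le> k x" "\<And>x. x \<in> I \<Longrightarrow> - h x \<le> k x"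
  shows "(\<integral>\<^sup>+x\<in>{l..r}. ennreal (f x * (x - S x)\<^sup>2 / 2) \<partial>lborel) \<le> (\<integral>\<^sup>+x. ennreal (k x) \<partial>m)"
proof -
  have sub: "{l..r} \<subseteq> I"
    using mem_is_interval_1_I[OF interval_I lr(1,2)] by auto
  let ?v = "\<lambda>x. f x * (x - S x)\<^sup>2 / 2"
  let ?B = "\<lambda>x. (x - S x) * std_normal_density (S x)"
  let ?B' = "\<lambda>x. std_normal_density (S x) - f x - S x * (x - S x) * f x"
  have cont: "continuous_on {l..r} f" "continuous_on {l..r} S" "continuous_on {l..r} k"
    using continuous_on_f continuous_on_S k(1) sub by (auto intro: continuous_on_subset)
  have v: "continuous_on {l..r} ?v" and kf: "continuous_on {l..r} (\<lambda>x. k x * f x)"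
    using cont by (auto intro!: continuous_intros)
  have B: "(?B' has_integral ?B r - ?B l) {l..r}"
  proof (rule fundamental_theorem_of_calculus)
    fix x assume "x \<in> {l..r}"
    then have x: "x \<in> I" using sub by auto
    have "0 < std_normal_density (S x)" by (simp add: normal_density_pos)
    then have "(?B has_real_derivative ?B' x) (at x)"
      by (auto intro!: derivative_eq_intros S_has_real_derivative[OF x]
          DERIV_chain2[OF std_normal_density_has_real_derivative] simp: field_simps)
    then show "(?B has_vector_derivative ?B' x) (at x within {l..r})"
      by (simp add: has_real_derivative_iff_has_vector_derivative has_vector_derivative_at_within)
  qed (use lr in auto)
  have "integral {l..r} ?v \<le> integral {l..r} (\<lambda>x. k x * f x) + (?B r - ?B l)"
    using energy_density_le k(3) sub
    by (intro has_integral_le[OF integrable_integral[OF integrable_continuous_real[OF v]]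
          has_integral_add[OF integrable_integral[OF integrable_continuous_real[OF kf]] B]]) auto
  moreover have "?B r \<le> 0" "0 \<le> ?B l"
    using S_ge[of r] S_le[of l] lr by (auto intro!: mult_nonpos_nonneg)
  ultimately have "integral {l..r} ?v \<le> integral {l..r} (\<lambda>x. k x * f x)" by linarith
  then have "(\<integral>\<^sup>+x\<in>{l..r}. ennreal (?v x) \<partial>lborel) \<le> (\<integral>\<^sup>+x\<in>{l..r}. ennreal (k x * f x) \<partial>lborel)"
    using v kf f_nonneg k(2) by (simp add: nn_integral_continuous_Icc ennreal_leI)
  also have "\<dots> \<le> (\<integral>\<^sup>+x. ennreal (f x) * ennreal (k x) \<partial>lborel)"
    using f_nonneg k(2)
    by (intro nn_integral_mono) (auto simp: ennreal_mult'[symmetric] mult.commute split: split_indicator)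
  also have "\<dots> = (\<integral>\<^sup>+x. ennreal (k x) \<partial>m)"
    using borel_measurable_continuous_onI[OF k(1)] unfolding m_eq by (subst nn_integral_density) auto
  finally show ?thesis .
qed

text \<open>Nothing is known about \<open>S\<close> at the ends of \<open>I\<close>, so
  \<open>I\<close> is exhausted by compact sets; the bound on each is the same, and monotone
  convergence finishes.\<close>

lemma energy_le:
  assumes k: "continuous_on UNIV k" "\<And>x. 0 \<le> k x" "\<And>x. x \<in> I \<Longrightarrow> - h x \<le> k x"
  shows "(\<integral>\<^sup>+x. ennreal ((x - S x)\<^sup>2 / 2) \<partial>m) \<le> (\<integral>\<^sup>+x. ennreal (k x) \<partial>m)"
proof -
  let ?v = "\<lambda>x. f x * (x - S x)\<^sup>2 / 2"
  let ?N = "density lborel (\<lambda>x. ennreal (?v x))"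
  obtain C :: "nat \<Rightarrow> real set" where C: "\<And>n. compact (C n)" "\<And>n. C n \<subseteq> I"
    "\<And>n. C n \<subseteq> interior (C (Suc n))" "(\<Union>n. C n) = I"
    using open_Union_compact_subsets[OF open_I] by metis
  have [measurable]: "C n \<in> sets borel" for n
    using C(1) compact_imp_closed borel_closed by blast
  have [measurable]: "I \<in> sets borel" using open_I by simp
  have bound: "emeasure ?N (C n) \<le> (\<integral>\<^sup>+x. ennreal (k x) \<partial>m)" for n
  proof -
    \<comment> \<open>Inserting \<open>a\<close> makes the set nonempty and places \<open>a\<close>
      between its extremes.\<close>
    have ne: "compact (insert a (C n))" "insert a (C n) \<noteq> {}" using C(1) by auto
    obtain l where l: "l \<in> insert a (C n)" "\<And>x. x \<in> insert a (C n) \<Longrightarrow> l \<le> x"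
      using compact_attains_inf[OF ne] by auto
    obtain r where r: "r \<in> insert a (C n)" "\<And>x. x \<in> insert a (C n) \<Longrightarrow> x \<le> r"
      using compact_attains_sup[OF ne] by auto
    have "emeasure ?N (C n) \<le> emeasure ?N {l..r}"
      using l(2) r(2) by (intro emeasure_mono) auto
    also have "\<dots> = (\<integral>\<^sup>+x\<in>{l..r}. ennreal (?v x) \<partial>lborel)"
      by (simp add: emeasure_density)
    also have "\<dots> \<le> (\<integral>\<^sup>+x. ennreal (k x) \<partial>m)"
      using l r C(2) a_mem k by (intro energy_Icc_le) auto
    finally show ?thesis .
  qed
  have "incseq C"
    using C(3) interior_subset by (intro incseq_SucI) blast
  then have "emeasure ?N I = (SUP n. emeasure ?N (C n))"
    using SUP_emeasure_incseq[of C ?N] by (simp add: C(4) image_subset_iff)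
  also have "\<dots> \<le> (\<integral>\<^sup>+x. ennreal (k x) \<partial>m)"
    using bound by (intro SUP_least) auto
  also have "emeasure ?N I = (\<integral>\<^sup>+x. ennreal (f x) * ennreal ((x - S x)\<^sup>2 / 2) \<partial>lborel)"
    by (subst emeasure_density, measurable)
      (auto intro!: nn_integral_cong simp: f_def ennreal_mult'[symmetric])
  also have "\<dots> = (\<integral>\<^sup>+x. ennreal ((x - S x)\<^sup>2 / 2) \<partial>m)"
    unfolding m_eq by (subst nn_integral_density) auto
  finally show ?thesis .
qed

section \<open>A lower bound for the relative potential\<close>

text \<open>Where the supporting line rises away from \<open>a\<close>, the density of
  \<open>m\<close> exceeds the Gaussian one by a factor of at most \<open>1 + \<epsilon>\<close>; on
  \<open>H'\<close> the slope reduces it further by \<open>exp (- \<bar>p\<bar>)\<close>. As the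
  masses of \<open>H\<close> agree, this reduction is at most of order
  \<open>\<epsilon>\<close>.\<close>

lemma half_line_slope_le:
  assumes [measurable]: "H \<in> sets borel" "H' \<in> sets borel" and H': "H' \<subseteq> H"
    and eq: "measure m H = measure std_normal_distribution H"
    and c: "0 < c" "2 * c \<le> measure std_normal_distribution H'" and \<epsilon>: "\<epsilon> < c"
    and ha: "exp (- h a) \<le> 1 + \<epsilon>"
    and support: "\<And>x. x \<in> I \<Longrightarrow> h a + p * (x - a) \<le> h x"
    and p: "\<And>x. x \<in> H \<Longrightarrow> 0 \<le> p * (x - a)" "\<And>x. x \<in> H' \<Longrightarrow> \<bar>p\<bar> \<le> p * (x - a)"
  shows "\<bar>p\<bar> \<le> \<epsilon> / c"
proof -
  let ?\<gamma> = std_normal_distribution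
  interpret G: real_distribution ?\<gamma> by (rule real_dist_normal_dist)
  \<comment> \<open>Truncation at \<open>1\<close> makes \<open>exp (- q) \<le> 1 - q / 2\<close>
    available; at the end \<open>\<epsilon> / c < 1\<close> shows that it was not active.\<close>
  define q where "q = min \<bar>p\<bar> 1"
  have q: "0 \<le> q" "q \<le> 1" "q \<le> \<bar>p\<bar>" by (auto simp: q_def)
  have \<epsilon>0: "0 < 1 + \<epsilon>" using ha by (meson exp_gt_zero less_le_trans)
  have "1 \<le> (1 + q) * (1 - q / 2)"
    using q mult_left_mono[OF q(2) q(1)] by (simp add: field_simps)
  also have "\<dots> \<le> exp q * (1 - q / 2)"
    using q by (intro mult_right_mono exp_ge_add_one_self) auto
  finally have expq: "exp (- q) \<le> 1 - q / 2" by (simp add: exp_minus field_simps)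
  have bound: "f x \<le> (1 + \<epsilon>) * w * std_normal_density x"
    if "exp (- (p * (x - a))) \<le> w" for x w
  proof (cases "x \<in> I")
    case True
    have "exp (- h x) \<le> exp (- h a) * exp (- (p * (x - a)))"
      using support[OF True] by (simp flip: exp_add)
    also have "\<dots> \<le> (1 + \<epsilon>) * w" using ha that \<epsilon>0 by (intro mult_mono) auto
    finally show ?thesis using True by (simp add: f_eq mult_right_mono)
  next
    case False
    have "0 \<le> w" using that by (meson exp_ge_zero order_trans)
    then show ?thesis using False \<epsilon>0 by (simp add: f_def)
  qed
  have diff: "measure ?\<gamma> (H - H') = measure ?\<gamma> H - measure ?\<gamma> H'"
    using H' by (simp add: G.finite_measure_Diff)
  have "measure m (H - H') \<le> (1 + \<epsilon>) * 1 * (measure ?\<gamma> H - measure ?\<gamma> H')"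
    unfolding diff[symmetric] using \<epsilon>0 p(1) by (intro measure_m_le bound) auto
  moreover have "measure m H' \<le> (1 + \<epsilon>) * (1 - q / 2) * measure ?\<gamma> H'"
  proof (intro measure_m_le bound)
    fix x assume "x \<in> H'"
    then have "exp (- (p * (x - a))) \<le> exp (- q)" using p(2)[of x] q by simp
    then show "exp (- (p * (x - a))) \<le> 1 - q / 2" using expq by linarith
  qed (use \<epsilon>0 q in auto)
  moreover have "measure m H = measure m (H - H') + measure m H'"
    using H' by (subst M.finite_measure_Union[symmetric]) (auto simp: Un_absorb2)
  moreover have "(1 + \<epsilon>) * (measure ?\<gamma> H - q / 2 * measure ?\<gamma> H')
      = (1 + \<epsilon>) * 1 * (measure ?\<gamma> H - measure ?\<gamma> H') + (1 + \<epsilon>) * (1 - q / 2) * measure ?\<gamma> H'"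
    by (simp add: algebra_simps)
  ultimately have "measure ?\<gamma> H \<le> (1 + \<epsilon>) * (measure ?\<gamma> H - q / 2 * measure ?\<gamma> H')"
    using eq by linarith
  \<comment> \<open>The factor \<open>2\<close> in the bound on \<open>c\<close> absorbs the one
    half in \<open>1 - q / 2\<close>.\<close>
  also have "\<dots> \<le> (1 + \<epsilon>) * (measure ?\<gamma> H - q * c)"
    using \<epsilon>0 mult_left_mono[OF c(2) q(1)] by (intro mult_left_mono) auto
  finally have le: "(1 + \<epsilon>) * (q * c) \<le> \<epsilon> * measure ?\<gamma> H" by (simp add: algebra_simps)
  \<comment> \<open>The sign of \<open>\<epsilon>\<close> is not assumed; it follows from
    \<open>le\<close>, whose left side is nonnegative.\<close>
  have "0 \<le> \<epsilon> * measure ?\<gamma> H" using le \<epsilon>0 q c by (smt (verit) mult_nonneg_nonneg)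
  moreover have "0 < measure ?\<gamma> H"
    using c G.finite_measure_mono[OF H'] by auto
  ultimately have "0 \<le> \<epsilon>" by (simp add: zero_le_mult_iff)
  have "q * c \<le> (1 + \<epsilon>) * (q * c)" using \<open>0 \<le> \<epsilon>\<close> q c by (simp add: algebra_simps)
  also have "\<dots> \<le> \<epsilon> * 1" using le \<open>0 \<le> \<epsilon>\<close> mult_left_mono[OF G.prob_le_1[of H]] by force
  finally have qc: "q \<le> \<epsilon> / c" using c by (simp add: field_simps)
  moreover have "\<epsilon> / c < 1" using \<epsilon> c by simp
  ultimately show ?thesis by (simp add: q_def min_def split: if_splits)
qed

text \<open>The sign of the slope decides on which side of \<open>a\<close> the supporting line
  rises. The slope bound is applied to that half-line, with \<open>H'\<close> its part at distance
  at least \<open>1\<close> from \<open>a\<close>.\<close>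

lemma minus_h_le:
  assumes c: "0 < c" "2 * c \<le> measure std_normal_distribution {a + 1..}"
      "2 * c \<le> measure std_normal_distribution {..a - 1}"
    and \<epsilon>: "\<epsilon> < c" and ha: "exp (- h a) \<le> 1 + \<epsilon>" and x: "x \<in> I"
  shows "- h x \<le> \<epsilon> + \<epsilon> / c * \<bar>x - a\<bar>"
proof -
  \<comment> \<open>This is the right derivative of \<open>h\<close> at \<open>a\<close>, a
    subgradient by convexity.\<close>
  define p where "p = Inf ((\<lambda>t. (h a - h t) / (a - t)) ` ({a<..} \<inter> I))"
  have support: "h a + p * (y - a) \<le> h y" if "y \<in> I" for y
    unfolding p_def
    using convex_le_Inf_differential[OF convex_h, of a y] a_mem open_I that by (simp add: interior_open)
  have "\<bar>p\<bar> \<le> \<epsilon> / c"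
  proof (cases "0 \<le> p")
    case True
    show ?thesis
    proof (rule half_line_slope_le[of "{a<..}" "{a + 1..}"])
      show "measure m {a<..} = measure std_normal_distribution {a<..}"
        by (simp add: measure_greaterThan real_distribution_m real_dist_normal_dist cdf_a)
      show "\<bar>p\<bar> \<le> p * (y - a)" if "y \<in> {a + 1..}" for y
        using True that mult_left_mono[of 1 "y - a" p] by auto
    qed (use c \<epsilon> ha support True in auto)
  next
    case False
    show ?thesis
    proof (rule half_line_slope_le[of "{..a}" "{..a - 1}"])
      show "measure m {..a} = measure std_normal_distribution {..a}"
        using cdf_a by (simp add: cdf_def)
      show "\<bar>p\<bar> \<le> p * (y - a)" if "y \<in> {..a - 1}" for y
        using False that mult_left_mono_neg[of "y - a" "- 1" p] by auto
    qed (use c \<epsilon> ha support False in \<open>auto simp: mult_nonpos_nonpos\<close>)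
  qed
  then have "\<bar>p * (x - a)\<bar> \<le> \<epsilon> / c * \<bar>x - a\<bar>"
    unfolding abs_mult by (intro mult_right_mono) auto
  moreover have "- h a \<le> \<epsilon>"
    using ha exp_ge_add_one_self[of "- h a"] by linarith
  ultimately show ?thesis using support[OF x] by linarith
qed

end

section \<open>An exponential Gaussian moment and the choice of constants\<close>

text \<open>The linear factor is at most another copy of the exponential, and the resulting
  \<open>exp (2 + 2 * \<bar>x - a\<bar>)\<close> is at most a sum of two exponentials. Completing
  the square turns each, times the Gaussian density, into a multiple of a normal density with mean
  \<open>2\<close> or \<open>- 2\<close>.\<close>

lemma gaussian_exp_moment_finite:
  "(\<integral>\<^sup>+x. ennreal ((1 + \<bar>x - a\<bar>) * exp (1 + \<bar>x - a\<bar>) * std_normal_density x) \<partial>lborel) < \<infinity>"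
proof -
  have "(1 + \<bar>x - a\<bar>) * exp (1 + \<bar>x - a\<bar>) * std_normal_density x
      \<le> exp (4 - 2 * a) * normal_density 2 1 x + exp (4 + 2 * a) * normal_density (- 2) 1 x" for x
  proof -
    have 1: "exp (2 + 2 * (x - a)) * std_normal_density x = exp (4 - 2 * a) * normal_density 2 1 x"
      and 2: "exp (2 - 2 * (x - a)) * std_normal_density x = exp (4 + 2 * a) * normal_density (- 2) 1 x"
      unfolding normal_density_def
      by (simp_all flip: exp_add) (simp_all add: power2_eq_square field_simps)
    have "(1 + \<bar>x - a\<bar>) * exp (1 + \<bar>x - a\<bar>) \<le> exp (1 + \<bar>x - a\<bar>) * exp (1 + \<bar>x - a\<bar>)"
      using exp_ge_add_one_self[of "1 + \<bar>x - a\<bar>"] by (intro mult_right_mono) auto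
    also have "\<dots> \<le> exp (2 + 2 * (x - a)) + exp (2 - 2 * (x - a))"
      by (cases "a \<le> x") (simp_all add: algebra_simps flip: exp_add)
    finally have "(1 + \<bar>x - a\<bar>) * exp (1 + \<bar>x - a\<bar>) * std_normal_density x
        \<le> (exp (2 + 2 * (x - a)) + exp (2 - 2 * (x - a))) * std_normal_density x"
      by (intro mult_right_mono) auto
    then show ?thesis using 1 2 by (simp add: distrib_right)
  qed
  then have "(\<integral>\<^sup>+x. ennreal ((1 + \<bar>x - a\<bar>) * exp (1 + \<bar>x - a\<bar>) * std_normal_density x) \<partial>lborel)
      \<le> (\<integral>\<^sup>+x. ennreal (exp (4 - 2 * a)) * ennreal (normal_density 2 1 x)
        + ennreal (exp (4 + 2 * a)) * ennreal (normal_density (- 2) 1 x) \<partial>lborel)"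
    by (intro nn_integral_mono) (simp add: ennreal_leI flip: ennreal_mult ennreal_plus)
  also have "\<dots> = ennreal (exp (4 - 2 * a)) + ennreal (exp (4 + 2 * a))"
  proof -
    have "(\<integral>\<^sup>+x. ennreal (normal_density \<mu> 1 x) \<partial>lborel) = 1" for \<mu>
      using prob_space.emeasure_space_1[OF prob_space_normal_density[of 1 \<mu>]]
      by (simp add: emeasure_density)
    then show ?thesis by (simp add: nn_integral_add nn_integral_cmult)
  qed
  also have "\<dots> < \<infinity>" by simp
  finally show ?thesis .
qed

lemma ennreal_sqrt_le: "x \<le> ennreal r \<Longrightarrow> 0 \<le> r \<Longrightarrow> ennreal_sqrt x \<le> ennreal (sqrt r)"
  unfolding ennreal_sqrt_def
  by (cases x) (auto simp: top_unique intro!: ennreal_leI)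

theorem proposition2p4:
  fixes \<theta> :: real
  assumes "0 < \<theta>" and "\<theta> < 1"
  shows "\<exists>\<delta>\<^sub>0>0. \<exists>C>0. \<forall>(I :: real set) (\<psi> :: real \<Rightarrow> real) (\<delta> :: real).
    open I \<longrightarrow> is_interval I \<longrightarrow> one_convex_on I \<psi> \<longrightarrow> prob_space (exp_measure I \<psi>) \<longrightarrow>
    0 < \<delta> \<longrightarrow> \<delta> < \<delta>\<^sub>0 \<longrightarrow>
    measure (exp_measure I \<psi>) ({..gauss_quantile \<theta>} \<inter> I) = \<theta> \<longrightarrow>
    exp (- \<psi> (gauss_quantile \<theta>)) \<le> exp (- gauss_potential (gauss_quantile \<theta>)) + \<delta> \<longrightarrow>
    W2 (exp_measure I \<psi>) std_normal_distribution \<le> ennreal (C * sqrt \<delta>)"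
proof -
  let ?\<gamma> = std_normal_distribution
  interpret G: real_distribution ?\<gamma> by (rule real_dist_normal_dist)
  define a where "a = gauss_quantile \<theta>"
  \<comment> \<open>\<open>\<kappa>\<close> converts the additive density bound at \<open>a\<close>
    into the relative one \<open>exp (- h a) \<le> 1 + \<kappa> * \<delta>\<close>.\<close>
  define \<kappa> where "\<kappa> = 1 / std_normal_density a"
  define c where "c = min (measure ?\<gamma> {a + 1..}) (measure ?\<gamma> {..a - 1}) / 2"
  \<comment> \<open>The two summands cover the value of \<open>- h\<close> at \<open>a\<close> and
    the slope of the supporting line.\<close>
  define K where "K = \<kappa> + \<kappa> / c"
  obtain M where M: "0 \<le> M" "(\<integral>\<^sup>+x. ennreal ((1 + \<bar>x - a\<bar>) * exp (1 + \<bar>x - a\<bar>)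
      * std_normal_density x) \<partial>lborel) = ennreal M"
    using gaussian_exp_moment_finite[of a] by (auto simp: less_top_ennreal)
  have \<kappa>: "0 < \<kappa>" by (simp add: \<kappa>_def normal_density_pos)
  have "0 < measure ?\<gamma> {a + 1<..}"
    using gauss_cdf_bounds[of "a + 1"] by (simp add: measure_greaterThan real_dist_normal_dist)
  also have "\<dots> \<le> measure ?\<gamma> {a + 1..}" by (intro G.finite_measure_mono) auto
  finally have "0 < measure ?\<gamma> {a + 1..}" .
  moreover have "0 < measure ?\<gamma> {..a - 1}"
    using gauss_cdf_bounds[of "a - 1"] by (simp add: cdf_def)
  ultimately have c: "0 < c" "2 * c \<le> measure ?\<gamma> {a + 1..}" "2 * c \<le> measure ?\<gamma> {..a - 1}"
    by (auto simp: c_def)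
  have K: "0 < K" using \<kappa> c(1) by (simp add: K_def add_pos_pos)
  \<comment> \<open>The threshold \<open>1 / K\<close> gives \<open>K * \<delta> < 1\<close>, hence
    both the smallness needed for the slope bound and an exponential majorant of \<open>f\<close>
    that is independent of \<open>\<delta>\<close>. The summand \<open>1\<close> keeps the final
    constant positive, as only \<open>0 \<le> M\<close> is known.\<close>
  have main: "W2 (exp_measure I \<psi>) ?\<gamma> \<le> ennreal ((sqrt (2 * K * M) + 1) * sqrt \<delta>)"
    if I: "open I" "is_interval I" "one_convex_on I \<psi>" "prob_space (exp_measure I \<psi>)"
      and \<delta>: "0 < \<delta>" "\<delta> < 1 / K"
      and \<theta>: "measure (exp_measure I \<psi>) ({..a} \<inter> I) = \<theta>"
      and fa: "exp (- \<psi> a) \<le> exp (- gauss_potential a) + \<delta>" for I \<psi> \<delta>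
  proof -
    interpret one_convex_prob I \<psi> using I by (rule one_convex_prob.intro)
    interpret one_convex_prob_quantile I \<psi> a
    proof
      have "measure m ({..a} \<inter> I) = measure m {..a}"
        using AE_I open_I by (intro M.finite_measure_eq_AE) (auto elim!: eventually_mono)
      then show "cdf m a = gauss_cdf a"
        using \<theta> assms by (simp add: cdf_def measure_std_normal_gauss_quantile a_def)
    qed
    have "exp (- h a) = exp (- \<psi> a) * \<kappa>"
      by (simp add: h_def \<kappa>_def exp_diff exp_minus field_simps flip: exp_gauss_potential)
    also have "\<dots> \<le> (std_normal_density a + \<delta>) * \<kappa>"
      using fa \<kappa> by (intro mult_right_mono) (simp_all add: exp_gauss_potential)
    also have "\<dots> = 1 + \<kappa> * \<delta>"
      using normal_density_pos[of 1 0 a] by (simp add: \<kappa>_def field_simps)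
    finally have ha: "exp (- h a) \<le> 1 + \<kappa> * \<delta>" .
    have K\<delta>: "K * \<delta> < 1" using \<delta> K by (simp add: field_simps)
    have "\<kappa> / c * \<delta> \<le> K * \<delta>" using \<kappa> \<delta> by (simp add: K_def distrib_right)
    then have "\<kappa> / c * \<delta> < 1" using K\<delta> by linarith
    then have small: "\<kappa> * \<delta> < c" using c(1) by (simp add: field_simps)
    let ?k = "\<lambda>x. K * \<delta> * (1 + \<bar>x - a\<bar>)"
    have k: "- h x \<le> ?k x" if "x \<in> I" for x
    proof -
      have "- h x \<le> \<kappa> * \<delta> + \<kappa> * \<delta> / c * \<bar>x - a\<bar>"
        using minus_h_le[OF c small ha that] .
      also have "\<dots> \<le> K * \<delta> + K * \<delta> * \<bar>x - a\<bar>"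
        using \<kappa> c \<delta> by (intro add_mono mult_right_mono) (auto simp: K_def field_simps)
      finally show ?thesis by (simp add: algebra_simps)
    qed
    have "(\<integral>\<^sup>+x. ennreal ((x - S x)\<^sup>2 / 2) \<partial>m) \<le> (\<integral>\<^sup>+x. ennreal (?k x) \<partial>m)"
      using K \<delta> k by (intro energy_le) (auto intro!: continuous_intros)
    also have "\<dots> = (\<integral>\<^sup>+x. ennreal (f x) * ennreal (?k x) \<partial>lborel)"
      unfolding m_eq by (subst nn_integral_density) auto
    also have "\<dots> \<le> (\<integral>\<^sup>+x. ennreal (K * \<delta>) * ennreal ((1 + \<bar>x - a\<bar>) * exp (1 + \<bar>x - a\<bar>)
        * std_normal_density x) \<partial>lborel)"
    proof (rule nn_integral_mono)
      fix x
      \<comment> \<open>Only the exponent is bounded with \<open>K * \<delta> < 1\<close>; the outer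
        factor \<open>K * \<delta>\<close> is kept and gives the linear order in
        \<open>\<delta>\<close>.\<close>
      have "f x \<le> exp (1 + \<bar>x - a\<bar>) * std_normal_density x"
      proof (cases "x \<in> I")
        case True
        have "?k x \<le> 1 * (1 + \<bar>x - a\<bar>)" using K\<delta> by (intro mult_right_mono) auto
        then have "- h x \<le> 1 + \<bar>x - a\<bar>" using order_trans[OF k[OF True]] by simp
        then show ?thesis using True by (simp add: f_eq mult_right_mono)
      qed (simp add: f_def)
      then have "f x * ?k x \<le> exp (1 + \<bar>x - a\<bar>) * std_normal_density x * ?k x"
        using K \<delta> by (intro mult_right_mono) auto
      then show "ennreal (f x) * ennreal (?k x) \<le> ennreal (K * \<delta>)
          * ennreal ((1 + \<bar>x - a\<bar>) * exp (1 + \<bar>x - a\<bar>) * std_normal_density x)"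
        using K \<delta> f_nonneg by (simp add: ennreal_leI mult_ac flip: ennreal_mult)
    qed
    also have "\<dots> = ennreal (K * \<delta> * M)"
      using K \<delta> M by (simp add: nn_integral_cmult ennreal_mult)
    finally have half: "(\<integral>\<^sup>+x. ennreal ((x - S x)\<^sup>2 / 2) \<partial>m) \<le> ennreal (K * \<delta> * M)" .
    have "(\<integral>\<^sup>+x. ennreal ((x - S x)\<^sup>2) \<partial>m) = (\<integral>\<^sup>+x. ennreal 2 * ennreal ((x - S x)\<^sup>2 / 2) \<partial>m)"
      by (intro nn_integral_cong) (simp flip: ennreal_mult del: ennreal_numeral)
    also have "\<dots> = ennreal 2 * (\<integral>\<^sup>+x. ennreal ((x - S x)\<^sup>2 / 2) \<partial>m)"
      by (intro nn_integral_cmult) measurable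
    also have "\<dots> \<le> ennreal 2 * ennreal (K * \<delta> * M)"
      using half by (intro mult_left_mono) auto
    also have "\<dots> = ennreal (2 * K * M * \<delta>)"
      using K \<delta> M by (simp add: mult_ac flip: ennreal_mult del: ennreal_numeral)
    finally have "W2 m ?\<gamma> \<le> ennreal (sqrt (2 * K * M * \<delta>))"
      using K \<delta> M by (intro order_trans[OF W2_le] ennreal_sqrt_le) auto
    also have "\<dots> \<le> ennreal ((sqrt (2 * K * M) + 1) * sqrt \<delta>)"
      using \<delta> by (intro ennreal_leI) (simp add: real_sqrt_mult algebra_simps)
    finally show ?thesis .
  qed
  show ?thesis
    using main K M(1)
    by (intro exI[of _ "1 / K"] exI[of _ "sqrt (2 * K * M) + 1"] conjI allI impI)
      (auto simp: a_def add_nonneg_pos)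
qed

end
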